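(* Let $X$ be a Banach space with $\dim(X)\ge 2$, with norm $\|\cdot\|$, and let $f(x)=\|x\|$ for $x\in X$. Suppose that for every nonempty bounded convex set $\Omega\subset X$ there exists $\sigma>0$ such that $f$ is $\sigma$-strongly quasiconvex on $\Omega$. Then $\|\cdot\|$ is uniformly convex, and for any $\sigma_1>0$ such that $f$ is $\sigma_1$-strongly quasiconvex on the closed unit ball of $X$, the modulus of convexity satisfies $\delta(\epsilon)\ge\frac{\sigma_1\epsilon^2}{8}$ for all $\epsilon\in[0,2]$.
   Context: Spaces are real. For $\sigma>0$, a function $f$ is $\sigma$-strongly quasiconvex on a nonempty convex set $\Omega$ if $f(\lambda x+(1-\lambda)y)\le\max\{f(x),f(y)\}-\frac{\sigma}{2}\lambda(1-\lambda)\|x-y\|^2$ for all $x,y\in\Omega$ and $0<\lambda<1$. The modulus of convexity $\delta\colon[0,2]\to\mathbb{R}$ of $X$ is $$\delta(\epsilon)=\inf\left\{1-\left\|\tfrac{x+y}{2}\right\| : \|x\|=\|y\|=1,\ \|x-y\|\ge\epsilon\right\}.$$ The norm (or $X$) is uniformly convex if $\delta(\epsilon)>0$ for every $\epsilon\in(0,2]$. *)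

theory Defs
  imports "HOL-Analysis.Analysis"
begin

(* The library function dim returns 0 on infinite-dimensional spaces, so "2 \<le> dim UNIV" would
   exclude them. The dimension is the cardinality of a basis, and an infinite one is at least n. *)
definition dimension_at_least :: "'a::real_vector itself \<Rightarrow> nat \<Rightarrow> bool" where
  "dimension_at_least _ n \<longleftrightarrow>
     (\<exists>B :: 'a set. independent B \<and> span B = UNIV \<and> (infinite B \<or> n \<le> card B))"

(* Meant for \<sigma> > 0 and S nonempty and convex. *)
definition strongly_quasiconvex_on ::
    "real \<Rightarrow> 'a::real_normed_vector set \<Rightarrow> ('a \<Rightarrow> real) \<Rightarrow> bool" where
  "strongly_quasiconvex_on \<sigma> S f \<longleftrightarrow>
     (\<forall>x\<in>S. \<forall>y\<in>S. \<forall>t. 0 < t \<and> t < 1 \<longrightarrow>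
        f (t *\<^sub>R x + (1 - t) *\<^sub>R y)
          \<le> max (f x) (f y) - \<sigma> / 2 * t * (1 - t) * (norm (x - y))\<^sup>2)"

(* Meant for e in [0,2] and a nonzero space: the set is then nonempty (take y = -x) and
   bounded below by 0, so the real infimum is the genuine one. *)
definition modulus_of_convexity :: "'a::real_normed_vector itself \<Rightarrow> real \<Rightarrow> real" where
  "modulus_of_convexity _ e =
     Inf {1 - norm ((x + y) /\<^sub>R 2) | x y :: 'a. norm x = 1 \<and> norm y = 1 \<and> e \<le> norm (x - y)}"

definition uniformly_convex :: "'a::real_normed_vector itself \<Rightarrow> bool" where
  "uniformly_convex X \<longleftrightarrow> (\<forall>e\<in>{0<..2}. 0 < modulus_of_convexity X e)"

end

theory Submission
  imports Defs
begin

text \<open>Everything happens at midpoints in the closed unit ball. For unit vectors x, y, strong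
  quasiconvexity of the norm with t = 1/2 gives |(x + y)/2| <= 1 - \<sigma>/8 |x - y|^2, so each
  competitor in the infimum defining the modulus is at least \<sigma> e^2/8 as soon as |x - y| >= e.
  This is \<open>modulus_of_convexity_lower_bound\<close>, which is the quantitative claim. Since
  the ball is bounded and convex, the hypothesis supplies some \<sigma> > 0 there, and for e > 0 the
  bound is positive: uniform convexity.\<close>

text \<open>Guarantees that unit vectors exist, so that the infimum in the modulus is not taken over
  the empty set.\<close>

lemma dimension_at_least_nonzero:
  assumes "dimension_at_least TYPE('a::real_vector) n" "0 < n"
  obtains b :: "'a::real_vector" where "b \<noteq> 0"
proof -
  obtain B :: "'a set" where "independent B" "infinite B \<or> n \<le> card B"
    using assms(1) unfolding dimension_at_least_def by blast
  moreover from this have "B \<noteq> {}"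
    using assms(2) by auto
  ultimately obtain b where "b \<in> B" "b \<noteq> 0"
    using dependent_zero by fastforce
  then show thesis
    by (intro that)
qed

lemma modulus_of_convexity_lower_bound:
  fixes v :: "'a::real_normed_vector"
  assumes "v \<noteq> 0" and \<sigma>: "0 \<le> \<sigma>"
    and sqc: "strongly_quasiconvex_on \<sigma> (cball (0::'a) 1) norm"
    and e: "0 \<le> e" "e \<le> 2"
  shows "\<sigma> * e\<^sup>2 / 8 \<le> modulus_of_convexity TYPE('a) e"
  unfolding modulus_of_convexity_def
proof (rule cInf_greatest)
  \<comment> \<open>The antipodal unit vectors u and -u lie at distance 2, hence are an admissible
    pair for every e <= 2.\<close>
  define u where "u = v /\<^sub>R norm v"
  have "norm u = 1"
    using \<open>v \<noteq> 0\<close> by (simp add: u_def)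
  moreover have "norm (u - - u) = 2"
    using \<open>norm u = 1\<close> by (simp flip: scaleR_2)
  ultimately have "norm u = 1 \<and> norm (- u) = 1 \<and> e \<le> norm (u - - u)"
    using e by simp
  then show "{1 - norm ((x + y) /\<^sub>R 2) | x y :: 'a. norm x = 1 \<and> norm y = 1 \<and> e \<le> norm (x - y)} \<noteq> {}"
    by blast
next
  fix z
  assume "z \<in> {1 - norm ((x + y) /\<^sub>R 2) | x y :: 'a. norm x = 1 \<and> norm y = 1 \<and> e \<le> norm (x - y)}"
  then obtain x y :: 'a where z: "z = 1 - norm ((x + y) /\<^sub>R 2)"
    and xy: "norm x = 1" "norm y = 1" "e \<le> norm (x - y)"
    by blast
  \<comment> \<open>The maximum is 1 on unit vectors, and \<sigma>/2 * 1/2 * 1/2 is the source of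
    the constant \<sigma>/8.\<close>
  have "norm ((1/2) *\<^sub>R x + (1 - 1/2) *\<^sub>R y)
      \<le> max (norm x) (norm y) - \<sigma> / 2 * (1/2) * (1 - 1/2) * (norm (x - y))\<^sup>2"
    using sqc[unfolded strongly_quasiconvex_on_def, rule_format, of x y "1/2"] xy by simp
  moreover have "(1/2) *\<^sub>R x + (1 - 1/2) *\<^sub>R y = (x + y) /\<^sub>R 2"
    by (simp add: scaleR_add_right inverse_eq_divide)
  ultimately have "\<sigma> * (norm (x - y))\<^sup>2 / 8 \<le> z"
    using xy z by simp
  \<comment> \<open>Replaces the actual distance by its lower bound e; squaring is monotone here
    because e >= 0.\<close>
  moreover have "\<sigma> * e\<^sup>2 \<le> \<sigma> * (norm (x - y))\<^sup>2"
    using \<sigma> e xy by (intro mult_left_mono power_mono) auto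
  ultimately show "\<sigma> * e\<^sup>2 / 8 \<le> z"
    by linarith
qed

theorem theorem3p3:
  assumes "dimension_at_least TYPE('a::banach) 2"
    and "\<And>\<Omega> :: 'a set. \<Omega> \<noteq> {} \<Longrightarrow> bounded \<Omega> \<Longrightarrow> convex \<Omega> \<Longrightarrow>
           \<exists>\<sigma>>0. strongly_quasiconvex_on \<sigma> \<Omega> (\<lambda>x. norm x)"
  shows "uniformly_convex TYPE('a) \<and>
         (\<forall>\<sigma>\<^sub>1>0. strongly_quasiconvex_on \<sigma>\<^sub>1 (cball (0::'a) 1) (\<lambda>x. norm x) \<longrightarrow>
            (\<forall>\<epsilon>\<in>{0..2}. modulus_of_convexity TYPE('a) \<epsilon> \<ge> \<sigma>\<^sub>1 * \<epsilon>\<^sup>2 / 8))"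
proof -
  obtain v :: 'a where "v \<noteq> 0"
    using dimension_at_least_nonzero[OF assms(1)] by auto
  then have bound: "\<sigma> * e\<^sup>2 / 8 \<le> modulus_of_convexity TYPE('a) e"
    if "0 < \<sigma>" "strongly_quasiconvex_on \<sigma> (cball (0::'a) 1) norm" "0 \<le> e" "e \<le> 2" for \<sigma> e
    using that by (intro modulus_of_convexity_lower_bound) auto
  \<comment> \<open>One constant for the whole ball bounds the modulus at all e
    simultaneously.\<close>
  obtain \<sigma> where \<sigma>: "\<sigma> > 0" "strongly_quasiconvex_on \<sigma> (cball (0::'a) 1) norm"
    using assms(2)[of "cball 0 1"] by auto
  have "0 < modulus_of_convexity TYPE('a) e" if "0 < e" "e \<le> 2" for e
  proof -
    have "0 < \<sigma> * e\<^sup>2 / 8"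
      using \<sigma> that by simp
    also have "\<dots> \<le> modulus_of_convexity TYPE('a) e"
      using \<sigma> that by (intro bound) auto
    finally show ?thesis .
  qed
  then show ?thesis
    using bound unfolding uniformly_convex_def by auto
qed

end
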